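(* Let $k\in\mathbb{N}$. If $k\ge 2$, then every $2$-dimensional grid is equitably $k$-list arborable.
   Context: $P_n$ denotes the path on $n$ vertices and $\square$ the Cartesian product. A $2$-dimensional grid is $P_{n_1}\square P_{n_2}$ with $n_1,n_2\ge 2$. A $k$-uniform list assignment $L$ for $G$ assigns to each vertex $v$ a set $L(v)$ of exactly $k$ colours; an $L$-colouring is a map $c$ with $c(v)\in L(v)$; it is equitable if every colour class has at most $\lceil |V(G)|/k\rceil$ vertices. $G$ is equitably $k$-list arborable if for every $k$-uniform list assignment $L$ there is an equitable $L$-colouring of $G$ in which every colour class induces an acyclic subgraph. *)

theory Defs
  imports Complex_Main "Graph_Theory.Graph_Theory"
begin

text \<open>An undirected graph is represented by the symmetric digraph that has both arcs
  \<open>(u, v)\<close> and \<open>(v, u)\<close> for every edge \<open>uv\<close>.\<close>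

definition path_graph :: "nat \<Rightarrow> nat pair_pre_digraph" where
  "path_graph n =
    \<lparr> pverts = {0..<n},
      parcs = {(i, j). i < n \<and> j < n \<and> (j = Suc i \<or> i = Suc j)} \<rparr>"

definition cartesian_product ::
    "'a pair_pre_digraph \<Rightarrow> 'b pair_pre_digraph \<Rightarrow> ('a \<times> 'b) pair_pre_digraph"
    (infixr \<open>\<box>\<close> 75) where
  "G \<box> H =
    \<lparr> pverts = pverts G \<times> pverts H,
      parcs = {((u, v), (u', v')).
         (u = u' \<and> u \<in> pverts G \<and> (v, v') \<in> parcs H) \<or>
         (v = v' \<and> v \<in> pverts H \<and> (u, u') \<in> parcs G)} \<rparr>"

lemma pair_graph_path_graph: "pair_graph (path_graph n)"
proof
  show "finite (parcs (path_graph n))"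
    by (rule finite_subset[of _ "{0..<n} \<times> {0..<n}"]) (auto simp: path_graph_def)
qed (auto simp: path_graph_def symmetric_def sym_def arcs_ends_def arc_to_ends_def)

lemma pair_graph_cartesian_product:
  assumes "pair_graph G" "pair_graph H"
  shows "pair_graph (G \<box> H)"
proof -
  interpret G: pair_graph G by fact
  interpret H: pair_graph H by fact
  show ?thesis
  proof
    show "finite (parcs (G \<box> H))"
      by (rule finite_subset[of _ "(pverts G \<times> pverts H) \<times> (pverts G \<times> pverts H)"])
        (auto simp: cartesian_product_def
          dest: G.in_arcsD1 G.in_arcsD2 H.in_arcsD1 H.in_arcsD2)
    show "symmetric (with_proj (G \<box> H))"
      using G.arcs_symmetric H.arcs_symmetric
      by (auto simp: symmetric_def arcs_ends_def arc_to_ends_def cartesian_product_def intro!: symI)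
  qed (auto simp: cartesian_product_def dest: G.pair_no_loops H.pair_no_loops
      G.in_arcsD1 G.in_arcsD2 H.in_arcsD1 H.in_arcsD2)
qed

text \<open>In a symmetric digraph the closed walk \<open>u, v, u\<close> along a single edge satisfies
  \<^const>\<open>pre_digraph.cycle\<close>, so \<^const>\<open>forest\<close> is not acyclicity of the underlying undirected
  graph.  For a simple graph, the undirected cycles are exactly the directed ones of length
  at least 3.\<close>

definition undirected_acyclic :: "('a, 'b) pre_digraph \<Rightarrow> bool" where
  "undirected_acyclic G \<longleftrightarrow> \<not> (\<exists>p. pre_digraph.cycle G p \<and> length p \<ge> 3)"

definition uniform_list_assignment ::
    "nat \<Rightarrow> ('a, 'b) pre_digraph \<Rightarrow> ('a \<Rightarrow> 'c set) \<Rightarrow> bool" where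
  "uniform_list_assignment k G L \<longleftrightarrow> (\<forall>v\<in>verts G. finite (L v) \<and> card (L v) = k)"

definition list_colouring ::
    "('a, 'b) pre_digraph \<Rightarrow> ('a \<Rightarrow> 'c set) \<Rightarrow> ('a \<Rightarrow> 'c) \<Rightarrow> bool" where
  "list_colouring G L c \<longleftrightarrow> (\<forall>v\<in>verts G. c v \<in> L v)"

definition colour_class :: "('a, 'b) pre_digraph \<Rightarrow> ('a \<Rightarrow> 'c) \<Rightarrow> 'c \<Rightarrow> 'a set" where
  "colour_class G c x = {v \<in> verts G. c v = x}"

definition equitable_colouring ::
    "nat \<Rightarrow> ('a, 'b) pre_digraph \<Rightarrow> ('a \<Rightarrow> 'c) \<Rightarrow> bool" where
  "equitable_colouring k G c \<longleftrightarrow>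
    (\<forall>x. int (card (colour_class G c x)) \<le> \<lceil>real (card (verts G)) / real k\<rceil>)"

text \<open>The first argument only fixes the type of colours, which is arbitrary.\<close>

definition equitably_list_arborable ::
    "'c itself \<Rightarrow> nat \<Rightarrow> ('a, 'b) pre_digraph \<Rightarrow> bool" where
  "equitably_list_arborable _ k G \<longleftrightarrow>
    (\<forall>L :: 'a \<Rightarrow> 'c set. uniform_list_assignment k G L \<longrightarrow>
      (\<exists>c. list_colouring G L c \<and> equitable_colouring k G c \<and>
        (\<forall>x. undirected_acyclic (G \<restriction> colour_class G c x))))"

end

theory Submission
  imports Defs
begin

text \<open>The argument works for every 2-degenerate graph of maximum degree at most 4.  Remove \<open>k\<close>
  vertices \<open>x\<^sub>1, \<dots>, x\<^sub>k\<close> at a time, where \<open>x\<^sub>1\<close> has at most 1 and \<open>x\<^sub>2\<close> at most 3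
  neighbours among the vertices that remain (a vertex \<open>x\<^sub>1\<close> of degree at most 2 together with a
  neighbour will do; if \<open>x\<^sub>1\<close> is isolated, take any other vertex of degree at most 2).
  Colour the rest inductively.  The colours that occur at least twice in the
  remaining neighbourhood of \<open>x\<^sub>i\<close> number at most 0, 1, 2 for \<open>i = 1\<close>, \<open>i = 2\<close>, \<open>i \<ge> 3\<close>;
  avoiding them, the removed vertices can be given distinct colours from their lists, choosing for
  \<open>x\<^sub>2\<close> and \<open>x\<^sub>1\<close> last.  Every colour class then gains at most one vertex, and that vertex has at
  most one neighbour in the class, so classes stay acyclic.\<close>

section \<open>Degeneracy and acyclic classes\<close>

text \<open>One notion serves twice: for a finite simple graph \<open>d = 1\<close> characterises
  forests, and \<open>d = 2\<close> supplies the vertices to remove. Quantifying over all subsets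
  makes it hereditary.\<close>

definition degenerate :: "nat \<Rightarrow> ('a \<times> 'a) set \<Rightarrow> 'a set \<Rightarrow> bool" where
  "degenerate d E C \<longleftrightarrow> (\<forall>W\<subseteq>C. W \<noteq> {} \<longrightarrow> (\<exists>v\<in>W. card (E `` {v} \<inter> W) \<le> d))"

lemma degenerateD:
  assumes "degenerate d E C" "W \<subseteq> C" "W \<noteq> {}"
  obtains v where "v \<in> W" "card (E `` {v} \<inter> W) \<le> d"
  using assms unfolding degenerate_def by blast

lemma degenerate_subset: "degenerate d E C \<Longrightarrow> D \<subseteq> C \<Longrightarrow> degenerate d E D"
  unfolding degenerate_def by blast

lemma degenerate_empty [simp]: "degenerate d E {}"
  by (simp add: degenerate_def)

text \<open>A subset containing \<open>s\<close> has \<open>s\<close> itself as witness, since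
  \<open>irrefl E\<close> keeps \<open>s\<close> out of its own neighbourhood; any other subset lies
  in \<open>C\<close>.\<close>

lemma degenerate_insert:
  assumes C: "degenerate d E C" and "finite C" "irrefl E" and s: "card (E `` {s} \<inter> C) \<le> d"
  shows "degenerate d E (insert s C)"
  unfolding degenerate_def
proof (intro allI impI)
  fix W assume W: "W \<subseteq> insert s C" "W \<noteq> {}"
  show "\<exists>v\<in>W. card (E `` {v} \<inter> W) \<le> d"
  proof (cases "s \<in> W")
    case True
    have "E `` {s} \<inter> W \<subseteq> E `` {s} \<inter> C"
      using W(1) \<open>irrefl E\<close> by (auto simp: irrefl_def)
    then have "card (E `` {s} \<inter> W) \<le> card (E `` {s} \<inter> C)"
      using \<open>finite C\<close> by (intro card_mono) auto
    then show ?thesis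
      using True s by (intro bexI[of _ s]) auto
  next
    case False
    with W have "W \<subseteq> C" by blast
    then show ?thesis
      using C W(2) by (meson degenerateD)
  qed
qed

lemma (in pre_digraph) cas_head_nth:
  assumes "cas u p v" "i < length p"
  shows "head G (p ! i) = (if Suc i < length p then tail G (p ! Suc i) else v)"
  using assms
proof (induction p arbitrary: u i)
  case (Cons e p)
  then show ?case
    by (cases i; cases p) auto
qed simp

text \<open>On a cycle of length at least 3 every vertex has two distinct neighbours, its
  predecessor and its successor, so the vertex set of the cycle violates degeneracy 1.\<close>

lemma undirected_acyclic_if_degenerate:
  assumes deg: "degenerate 1 (parcs G) C" and sym: "sym (parcs G)" and "finite C"
  shows "undirected_acyclic (with_proj G \<restriction> C)"
  unfolding undirected_acyclic_def
proof
  let ?H = "with_proj G \<restriction> C"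
  assume "\<exists>p. pre_digraph.cycle ?H p \<and> length p \<ge> 3"
  then obtain p u where walk: "pre_digraph.awalk ?H u p u"
    and dist: "distinct (tl (pre_digraph.awalk_verts ?H u p))" and len: "length p \<ge> 3"
    unfolding pre_digraph.cycle_def by auto
  have cas: "pre_digraph.cas ?H u p u" and arcs: "set p \<subseteq> arcs ?H"
    using walk by (auto simp: pre_digraph.awalk_def)
  define m where "m = length p"
  \<comment> \<open>Heads of arcs list each vertex of the closed walk once, because only the
    starting vertex is repeated.\<close>
  define h where "h i = snd (p ! i)" for i
  have "pre_digraph.awalk_verts ?H u p = fst (hd p) # map snd p"
    using pre_digraph.awalk_verts_conv'[OF cas] len by auto
  with dist have "distinct (map snd p)" by simp
  then have inj: "i = j" if "i < m" "j < m" "h i = h j" for i j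
    using that by (auto simp: distinct_conv_nth m_def h_def)
  define nxt where "nxt i = (if Suc i < m then Suc i else 0)" for i
  have tail0: "fst (p ! 0) = u"
    using cas len by (cases p) (auto simp: pre_digraph.cas.simps)
  have step: "(h i, h (nxt i)) \<in> parcs G" and h_in: "h i \<in> C" if "i < m" for i
  proof -
    have "nxt i < m"
      using that by (auto simp: nxt_def)
    then have "p ! nxt i \<in> arcs ?H"
      using arcs by (auto simp: m_def dest!: nth_mem)
    moreover have "fst (p ! nxt i) = h i"
      using pre_digraph.cas_head_nth[OF cas, of i] that tail0
      by (auto simp: m_def h_def nxt_def)
    ultimately show "(h i, h (nxt i)) \<in> parcs G" "h i \<in> C"
      by (auto simp: h_def prod_eq_iff) (metis prod.collapse)+
  qed
  define W where "W = h ` {..<m}"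
  have "0 < m"
    using len unfolding m_def by linarith
  then have "W \<subseteq> C" "W \<noteq> {}"
    using h_in by (auto simp: W_def lessThan_empty_iff)
  with deg obtain v where "v \<in> W" and v: "card (parcs G `` {v} \<inter> W) \<le> 1"
    by (rule degenerateD)
  then obtain i where i: "i < m" "v = h i"
    by (auto simp: W_def)
  \<comment> \<open>The cyclic predecessor of \<open>i\<close>. It differs from \<open>nxt i\<close>
    because \<open>m\<close> is at least 3; for \<open>m = 2\<close> the two would coincide.\<close>
  define j where "j = (if i = 0 then m - 1 else i - 1)"
  have j: "j < m" "nxt j = i" "nxt i < m" "nxt i \<noteq> j"
    using i len by (auto simp: j_def nxt_def m_def)
  have "{h j, h (nxt i)} \<subseteq> parcs G `` {v} \<inter> W"
    using step[of i] step[of j] i j sym by (auto simp: W_def sym_def)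
  then have "card {h j, h (nxt i)} \<le> card (parcs G `` {v} \<inter> W)"
    using \<open>finite C\<close> \<open>W \<subseteq> C\<close> by (intro card_mono) (auto intro: finite_subset)
  moreover have "h j \<noteq> h (nxt i)"
    using inj j by metis
  ultimately show False
    using v by simp
qed

section \<open>Repeated colours and distinct choices\<close>

text \<open>The fibres over distinct values are disjoint, and each repeated value uses up at least
  two elements of \<open>A\<close>.\<close>

lemma card_repeated_values:
  assumes "finite A"
  shows "finite {x. card {a\<in>A. f a = x} \<ge> 2}"
    and "2 * card {x. card {a\<in>A. f a = x} \<ge> 2} \<le> card A"
proof -
  let ?R = "{x. card {a\<in>A. f a = x} \<ge> 2}"
  have "?R \<subseteq> f ` A"
  proof
    fix x assume "x \<in> ?R"
    then have "{a\<in>A. f a = x} \<noteq> {}" by (intro notI) simp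
    then show "x \<in> f ` A" by auto
  qed
  then show fin: "finite ?R"
    using assms finite_surj by blast
  have "2 * card ?R = (\<Sum>x\<in>?R. 2)" by simp
  also have "\<dots> \<le> (\<Sum>x\<in>?R. card {a\<in>A. f a = x})"
    by (intro sum_mono) auto
  also have "\<dots> = card (\<Union>x\<in>?R. {a\<in>A. f a = x})"
    using fin assms by (subst card_UN_disjoint) auto
  also have "\<dots> \<le> card A"
    using assms by (intro card_mono) auto
  finally show "2 * card ?R \<le> card A" .
qed

text \<open>Greedy step: \<open>T\<close> blocks at most \<open>card T\<close> elements of
  \<open>A x\<close>. It is kept separate so that elements with longer lists can be served
  last.\<close>

lemma distinct_choice_insert:
  assumes "\<exists>d. inj_on d T \<and> (\<forall>t\<in>T. d t \<in> A t)"
    and "finite T" "x \<notin> T" "card T < card (A x)"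
  shows "\<exists>d. inj_on d (insert x T) \<and> (\<forall>t\<in>insert x T. d t \<in> A t)"
proof -
  from assms(1) obtain d where d: "inj_on d T" "\<And>t. t \<in> T \<Longrightarrow> d t \<in> A t" by blast
  have "card (d ` T) < card (A x)"
    using assms(2,4) card_image_le order_le_less_trans by blast
  then obtain y where y: "y \<in> A x" "y \<notin> d ` T"
    using assms(2) by (meson card_mono finite_imageI linorder_not_less subsetI)
  have "inj_on (d(x := y)) (insert x T)"
    using d(1) y(2) \<open>x \<notin> T\<close> by (auto simp: inj_on_def)
  then show ?thesis
    using d(2) y(1) by (intro exI[of _ "d(x := y)"]) auto
qed

lemma distinct_choice:
  assumes "finite T" "\<And>t. t \<in> T \<Longrightarrow> card T \<le> card (A t)"
  shows "\<exists>d. inj_on d T \<and> (\<forall>t\<in>T. d t \<in> A t)"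
proof -
  \<comment> \<open>Inducting over subsets \<open>U\<close> keeps the bound \<open>card T\<close> on
    the list sizes fixed.\<close>
  have "\<exists>d. inj_on d U \<and> (\<forall>t\<in>U. d t \<in> A t)" if "finite U" "U \<subseteq> T" for U
    using that
  proof (induction U)
    case (insert x U)
    have "card (insert x U) \<le> card T"
      using insert.prems assms(1) by (intro card_mono)
    also have "\<dots> \<le> card (A x)"
      using insert.prems assms(2) by blast
    finally show ?case
      using insert by (intro distinct_choice_insert) auto
  qed simp
  from this[of T] show ?thesis
    using assms(1) by blast
qed

section \<open>Removing and recolouring \<open>k\<close> vertices\<close>

text \<open>Injectivity of \<open>d\<close> on \<open>S\<close> lets each class gain at most one
  vertex, and \<open>new\<close> makes that vertex admissible for
  \<open>degenerate_insert\<close>.\<close>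

lemma extend_colouring:
  fixes c d :: "'a \<Rightarrow> 'c" and S V :: "'a set"
  defines "c' \<equiv> \<lambda>v. if v \<in> S then d v else c v"
  assumes "finite V" "S \<subseteq> V" "irrefl E" and inj: "inj_on d S"
    and old: "degenerate 1 E {v\<in>V - S. c v = x}" "card {v\<in>V - S. c v = x} \<le> q"
    and new: "\<And>s. s \<in> S \<Longrightarrow> card (E `` {s} \<inter> {v\<in>V - S. c v = d s}) \<le> 1"
  shows "degenerate 1 E {v\<in>V. c' v = x} \<and> card {v\<in>V. c' v = x} \<le> Suc q"
proof (cases "x \<in> d ` S")
  case True
  then obtain s where s: "s \<in> S" "x = d s" by auto
  then have eq: "{v\<in>V. c' v = x} = insert s {v\<in>V - S. c v = x}"
    using inj \<open>S \<subseteq> V\<close> by (auto simp: c'_def inj_on_def)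
  have "degenerate 1 E (insert s {v\<in>V - S. c v = x})"
    using old(1) new[OF s(1)] s(2) \<open>finite V\<close> \<open>irrefl E\<close>
    by (intro degenerate_insert) auto
  moreover have "card (insert s {v\<in>V - S. c v = x}) \<le> Suc q"
    using old(2) \<open>finite V\<close> s(1) by simp
  ultimately show ?thesis
    unfolding eq by blast
next
  case False
  then have "{v\<in>V. c' v = x} = {v\<in>V - S. c v = x}"
    by (auto simp: c'_def)
  then show ?thesis
    using old by simp
qed

lemma removable_pair:
  assumes deg: "degenerate 2 E V" and "sym E" "finite V" "card V \<ge> 2"
    and max: "\<And>v. v \<in> V \<Longrightarrow> card (E `` {v} \<inter> V) \<le> 4"
  obtains x1 x2 where "x1 \<in> V" "x2 \<in> V" "x1 \<noteq> x2"
    "card (E `` {x1} \<inter> (V - {x1, x2})) \<le> 1" "card (E `` {x2} \<inter> (V - {x1, x2})) \<le> 3"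
proof -
  from assms have "V \<noteq> {}" by auto
  with deg obtain x1 where x1: "x1 \<in> V" "card (E `` {x1} \<inter> V) \<le> 2"
    by (rule degenerateD[OF _ subset_refl])
  have mono: "card (E `` {x} \<inter> (V - {x1, y})) \<le> card (E `` {x} \<inter> V - {z})"
    if "z \<in> {x1, y}" for x y z
    using \<open>finite V\<close> that by (intro card_mono) auto
  show thesis
  proof (cases "E `` {x1} \<inter> (V - {x1}) = {}")
    case False
    then obtain x2 where x2: "(x1, x2) \<in> E" "x2 \<in> V" "x2 \<noteq> x1" by auto
    then have "(x2, x1) \<in> E"
      using \<open>sym E\<close> by (auto dest: symD)
    \<comment> \<open>The edge joining \<open>x1\<close> and \<open>x2\<close> counts in both
      degrees, so the bounds 2 and 4 drop to 1 and 3.\<close>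
    then have "card (E `` {x1} \<inter> V - {x2}) \<le> 1" "card (E `` {x2} \<inter> V - {x1}) \<le> 3"
      using x1 x2 max[of x2] \<open>finite V\<close> by (auto simp: card_Diff_singleton)
    with mono[of x2 x2 x1] mono[of x1 x2 x2] show thesis
      using x1 x2 by (intro that[of x1 x2]) auto
  next
    case True
    have "V - {x1} \<noteq> {}"
      using \<open>card V \<ge> 2\<close> card_mono[of "{x1}" V] by auto
    with deg obtain x2 where x2: "x2 \<in> V - {x1}" "card (E `` {x2} \<inter> (V - {x1})) \<le> 2"
      by (rule degenerateD[OF _ Diff_subset])
    have "E `` {x1} \<inter> (V - {x1, x2}) = {}"
      using True by blast
    moreover have "card (E `` {x2} \<inter> (V - {x1, x2})) \<le> card (E `` {x2} \<inter> (V - {x1}))"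
      using \<open>finite V\<close> by (intro card_mono) auto
    ultimately show thesis
      using x1 x2 by (intro that[of x1 x2]) auto
  qed
qed

text \<open>Induction on the class capacity \<open>q\<close>: each round removes \<open>k\<close>
  vertices and costs one unit of capacity. All hypotheses on \<open>V\<close> pass to
  subsets.\<close>

lemma equitable_forest_colouring:
  fixes L :: "'a \<Rightarrow> 'c set"
  assumes "k \<ge> 2" "sym E" "irrefl E"
    and "finite V" "degenerate 2 E V" "\<And>v. v \<in> V \<Longrightarrow> card (E `` {v} \<inter> V) \<le> 4"
    and "\<And>v. v \<in> V \<Longrightarrow> finite (L v) \<and> card (L v) = k"
    and "card V \<le> q * k"
  shows "\<exists>c. (\<forall>v\<in>V. c v \<in> L v) \<and>
    (\<forall>x. degenerate 1 E {v\<in>V. c v = x} \<and> card {v\<in>V. c v = x} \<le> q)"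
  using assms(4-)
proof (induction q arbitrary: V)
  case 0
  then show ?case by simp
next
  case (Suc q)
  note fin = \<open>finite V\<close>
  show ?case
  proof (cases "card V \<le> k")
    case True
    with fin Suc.prems(4) have "\<exists>d. inj_on d V \<and> (\<forall>v\<in>V. d v \<in> L v)"
      by (intro distinct_choice) auto
    then obtain d where d: "inj_on d V" "\<And>v. v \<in> V \<Longrightarrow> d v \<in> L v" by blast
    \<comment> \<open>With \<open>S = V\<close> no vertex is coloured beforehand; \<open>d\<close>
      merely fills the place of the old colouring.\<close>
    have "degenerate 1 E {v\<in>V. d v = x} \<and> card {v\<in>V. d v = x} \<le> Suc q" for x
      using extend_colouring[of V V E d d x q] fin d(1) assms(3) by simp
    with d(2) show ?thesis by blast
  next
    case False
    with \<open>k \<ge> 2\<close> have "card V \<ge> 2" by simp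
    then obtain x1 x2 where x: "x1 \<in> V" "x2 \<in> V" "x1 \<noteq> x2"
      and x1: "card (E `` {x1} \<inter> (V - {x1, x2})) \<le> 1"
      and x2: "card (E `` {x2} \<inter> (V - {x1, x2})) \<le> 3"
      using removable_pair[of E V] Suc.prems assms(2) by metis
    have "k - 2 \<le> card (V - {x1, x2})"
      using x fin False by (simp add: card_Diff_subset)
    then obtain T where T: "T \<subseteq> V - {x1, x2}" "card T = k - 2" "finite T"
      by (rule obtain_subset_with_card_n)
    define S where "S = insert x1 (insert x2 T)"
    have notin: "x1 \<notin> insert x2 T" "x2 \<notin> T"
      using T(1) x(3) by auto
    then have S: "S \<subseteq> V" "card S = k"
      using T x(1,2) \<open>k \<ge> 2\<close> by (auto simp: S_def)
    have "card (V - S) \<le> q * k"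
      using Suc.prems(5) S fin by (simp add: card_Diff_subset finite_subset)
    moreover have "card (E `` {v} \<inter> (V - S)) \<le> 4" if "v \<in> V - S" for v
    proof -
      have "card (E `` {v} \<inter> (V - S)) \<le> card (E `` {v} \<inter> V)"
        using fin by (intro card_mono) auto
      also have "\<dots> \<le> 4" using Suc.prems(3) that by blast
      finally show ?thesis .
    qed
    moreover have "degenerate 2 E (V - S)"
      using Suc.prems(2) degenerate_subset by blast
    ultimately have "\<exists>c. (\<forall>v\<in>V - S. c v \<in> L v) \<and>
        (\<forall>x. degenerate 1 E {v\<in>V - S. c v = x} \<and> card {v\<in>V - S. c v = x} \<le> q)"
      using fin Suc.prems(4) by (intro Suc.IH) auto
    then obtain c where c: "\<And>v. v \<in> V - S \<Longrightarrow> c v \<in> L v"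
      "\<And>x. degenerate 1 E {v\<in>V - S. c v = x}" "\<And>x. card {v\<in>V - S. c v = x} \<le> q"
      by blast
    \<comment> \<open>A colour outside \<open>R v\<close> occurs on at most one remaining neighbour
      of \<open>v\<close>, which is what \<open>extend_colouring\<close> asks for.\<close>
    define R where "R v = {x. card {u \<in> E `` {v} \<inter> (V - S). c u = x} \<ge> 2}" for v
    define A where "A v = L v - R v" for v
    \<comment> \<open>Halving rounds down, so up to 1, 3 or 5 neighbours forbid at most 0, 1 or 2
      colours.\<close>
    have A: "k \<le> card (A v) + r" if "v \<in> S" "card (E `` {v} \<inter> (V - S)) \<le> Suc (2 * r)" for v r
    proof -
      have "finite (E `` {v} \<inter> (V - S))"
        using fin by simp
      note R = card_repeated_values[OF this, of c, folded R_def]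
      have "card (R v) \<le> r"
        using R(2) that(2) by linarith
      moreover have "card (L v) - card (R v) \<le> card (A v)"
        unfolding A_def using R(1) by (rule diff_card_le_card_Diff)
      moreover have "card (L v) = k"
        using Suc.prems(4) S(1) that(1) by blast
      ultimately show ?thesis by linarith
    qed
    have less: "card (E `` {v} \<inter> (V - S)) \<le> n" if "card (E `` {v} \<inter> (V - {x1, x2})) \<le> n" for v n
      using that by (rule order_trans[rotated]) (use fin in \<open>auto intro!: card_mono simp: S_def\<close>)
    \<comment> \<open>The available lists have at least \<open>k - 2\<close> colours on
      \<open>T\<close>, \<open>k - 1\<close> at \<open>x2\<close> and \<open>k\<close> at
      \<open>x1\<close>: just enough when chosen in this order.\<close>
    have "card T \<le> card (A t)" if "t \<in> T" for t
    proof -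
      have "card (E `` {t} \<inter> (V - S)) \<le> card (E `` {t} \<inter> V)"
        using fin by (intro card_mono) auto
      also have "\<dots> \<le> 4" using Suc.prems(3) that T(1) by blast
      finally show ?thesis
        using A[of t 2] that T(2) by (simp add: S_def)
    qed
    with T(3) have "\<exists>d. inj_on d T \<and> (\<forall>t\<in>T. d t \<in> A t)"
      by (rule distinct_choice)
    moreover have "card T < card (A x2)"
      using A[of x2 1] less[OF x2] T(2) \<open>k \<ge> 2\<close> by (simp add: S_def)
    ultimately have "\<exists>d. inj_on d (insert x2 T) \<and> (\<forall>t\<in>insert x2 T. d t \<in> A t)"
      using T(3) notin(2) by (intro distinct_choice_insert)
    moreover have "card (insert x2 T) < card (A x1)"
      using A[of x1 0] less[OF x1] T(2,3) notin(2) \<open>k \<ge> 2\<close> by (simp add: S_def)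
    ultimately have "\<exists>d. inj_on d S \<and> (\<forall>s\<in>S. d s \<in> A s)"
      unfolding S_def using finite.insertI[OF T(3)] notin(1)
      by (intro distinct_choice_insert[of "insert x2 T"])
    then obtain d where d: "inj_on d S" "\<And>s. s \<in> S \<Longrightarrow> d s \<in> A s" by blast
    let ?c = "\<lambda>v. if v \<in> S then d v else c v"
    have "card (E `` {s} \<inter> {v\<in>V - S. c v = d s}) \<le> 1" if "s \<in> S" for s
    proof -
      have "E `` {s} \<inter> {v\<in>V - S. c v = d s} = {u \<in> E `` {s} \<inter> (V - S). c u = d s}"
        by auto
      then show ?thesis
        using d(2)[OF that] by (simp add: A_def R_def)
    qed
    then have "degenerate 1 E {v\<in>V. ?c v = x} \<and> card {v\<in>V. ?c v = x} \<le> Suc q" for x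
      by (intro extend_colouring fin S(1) assms(3) d(1) c) auto
    moreover have "?c v \<in> L v" if "v \<in> V" for v
      using that c(1)[of v] d(2)[of v] by (auto simp: A_def)
    ultimately show ?thesis
      by (intro exI[of _ ?c] conjI allI ballI) blast+
  qed
qed

section \<open>Neighbourhoods in the grid\<close>

text \<open>Truncated subtraction may put \<open>(a, b)\<close> itself into the first set at the
  border, which is harmless for an upper bound.\<close>

lemma grid_neighbours:
  assumes "((a, b), (a', b')) \<in> parcs (path_graph n1 \<box> path_graph n2)"
  shows "(a', b') \<in> {(Suc a, b), (a, Suc b), (a - 1, b), (a, b - 1)}"
    and "a + b \<le> a' + b' \<Longrightarrow> (a', b') \<in> {(Suc a, b), (a, Suc b)}"
  using assms by (auto simp: cartesian_product_def path_graph_def)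

lemma card_grid_neighbours:
  "card (parcs (path_graph n1 \<box> path_graph n2) `` {v} \<inter> V) \<le> 4"
proof (cases v)
  case (Pair a b)
  let ?N = "[(Suc a, b), (a, Suc b), (a - 1, b), (a, b - 1)]"
  have "card (parcs (path_graph n1 \<box> path_graph n2) `` {v} \<inter> V) \<le> card (set ?N)"
    using grid_neighbours(1)[of a b _ _ n1 n2] by (intro card_mono) (auto simp: Pair)
  also have "\<dots> \<le> 4"
    using card_length[of ?N] by simp
  finally show ?thesis .
qed

text \<open>A vertex of \<open>W\<close> with least coordinate sum can have neighbours in
  \<open>W\<close> only in the two increasing directions.\<close>

lemma degenerate_grid: "degenerate 2 (parcs (path_graph n1 \<box> path_graph n2)) V"
  unfolding degenerate_def
proof (intro allI impI)
  fix W :: "(nat \<times> nat) set" assume "W \<noteq> {}"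
  then obtain w where "w \<in> W" by blast
  then obtain v where v: "v \<in> W" "\<forall>w. w \<in> W \<longrightarrow> fst v + snd v \<le> fst w + snd w"
    using ex_has_least_nat[of "\<lambda>w. w \<in> W" w "\<lambda>w. fst w + snd w"] by blast
  obtain a b where "v = (a, b)"
    by (rule prod.exhaust)
  with v have ab: "(a, b) \<in> W"
    and min: "\<And>a' b'. (a', b') \<in> W \<Longrightarrow> a + b \<le> a' + b'"
    by auto
  let ?N = "[(Suc a, b), (a, Suc b)]"
  have "card (parcs (path_graph n1 \<box> path_graph n2) `` {(a, b)} \<inter> W) \<le> card (set ?N)"
    using grid_neighbours(2)[of a b _ _ n1 n2] min by (intro card_mono) auto
  also have "\<dots> \<le> 2"
    using card_length[of ?N] by simp
  finally show "\<exists>v\<in>W. card (parcs (path_graph n1 \<box> path_graph n2) `` {v} \<inter> W) \<le> 2"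
    using ab by blast
qed

theorem theorem6:
  fixes k n1 n2 :: nat
  assumes "k \<ge> 2" and "n1 \<ge> 2" and "n2 \<ge> 2"
  shows "equitably_list_arborable TYPE('c) k (with_proj (path_graph n1 \<box> path_graph n2))"
  unfolding equitably_list_arborable_def
proof (intro allI impI)
  let ?P = "path_graph n1 \<box> path_graph n2"
  let ?V = "pverts ?P"
  fix L :: "nat \<times> nat \<Rightarrow> 'c set"
  assume L: "uniform_list_assignment k (with_proj ?P) L"
  interpret pair_graph ?P
    by (intro pair_graph_cartesian_product pair_graph_path_graph)
  have sym: "sym (parcs ?P)"
    using arcs_symmetric by (auto simp: sym_def)
  have irrefl: "irrefl (parcs ?P)"
    by (intro irreflI notI) (drule pair_no_loops, simp)
  \<comment> \<open>The required class bound; \<open>nat r\<close> becomes the capacity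
    \<open>q\<close>, and rounding up gives \<open>card ?V \<le> nat r * k\<close>.\<close>
  define r where "r = \<lceil>real (card ?V) / real k\<rceil>"
  have "r \<ge> 0"
    unfolding r_def using ceiling_mono[of 0 "real (card ?V) / real k"] by simp
  have "0 < real k"
    using \<open>k \<ge> 2\<close> by simp
  then have "real (card ?V) \<le> of_int r * real k"
    unfolding r_def using le_of_int_ceiling pos_divide_le_eq by blast
  also have "\<dots> = real (nat r * k)"
    using \<open>r \<ge> 0\<close> by simp
  finally have "card ?V \<le> nat r * k"
    using of_nat_le_iff by blast
  then obtain c where c: "\<And>v. v \<in> ?V \<Longrightarrow> c v \<in> L v"
    "\<And>x. degenerate 1 (parcs ?P) {v\<in>?V. c v = x}" "\<And>x. card {v\<in>?V. c v = x} \<le> nat r"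
    using equitable_forest_colouring[OF \<open>k \<ge> 2\<close> sym irrefl pair_finite_verts degenerate_grid
        card_grid_neighbours, of L "nat r"] L
    by (auto simp: uniform_list_assignment_def)
  have "undirected_acyclic (with_proj ?P \<restriction> {v\<in>?V. c v = x})" for x
    using c(2) sym pair_finite_verts by (intro undirected_acyclic_if_degenerate) auto
  moreover have "int (card {v\<in>?V. c v = x}) \<le> r" for x
    using c(3)[of x] \<open>r \<ge> 0\<close> by linarith
  ultimately show "\<exists>c. list_colouring (with_proj ?P) L c \<and> equitable_colouring k (with_proj ?P) c \<and>
      (\<forall>x. undirected_acyclic (with_proj ?P \<restriction> colour_class (with_proj ?P) c x))"
    using c(1)
    by (intro exI[of _ c])
      (simp add: list_colouring_def equitable_colouring_def colour_class_def r_def)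
qed

end
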